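(* Let $d\ge1$, $\sigma\in(0,1)$, $\mu_1,\mu_2\in\mathbb R^d$ with $\|\mu_1\|=\|\mu_2\|$, and $\pi_1,\pi_2>0$ with $\pi_1+\pi_2=1$ and $\pi_1<\pi_2$. Consider the two-component Gaussian mixture $p_0(x\mid y)=\pi_1\mathcal N(x;\mu_1,\sigma^2I_d)+\pi_2\mathcal N(x;\mu_2,\sigma^2I_d)$. Assume that the zero-thrust sets exist for small times, i.e. there is $t_0\in(0,1)$ such that the set $S_t$ defined in the context is nonempty for every $t\in[0,t_0]$. Then there exist $t_{s_2}\in(0,1)$ and a nonempty open region $U_{s_2}\subset\mathbb R^d$, both depending only on $(\pi_k,\mu_k,\sigma)$ and not on $\omega$, such that for every $\omega\ge1$: if $x_{t_{s_2}}\in U_{s_2}$ and $x_t$ follows the CFG probability flow ODE with weight $\omega$ on $[0,t_{s_2}]$, then for all $t\in[0,t_{s_2}]$, $$\pi_1\,\mathcal N\big(x_t;(1-t)\mu_1,(t^2+(1-t)^2\sigma^2)I_d\big)>\pi_2\,\mathcal N\big(x_t;(1-t)\mu_2,(t^2+(1-t)^2\sigma^2)I_d\big).$$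
   Context: Here $\mathcal N(x;m,C)$ denotes the Gaussian density with mean $m$ and covariance $C$ evaluated at $x$. Setting. The unconditional data law is $p_0=\mathcal N(0,I_d)$; the conditional data law (for a fixed condition $y$) is the mixture in the statement. Data are noised by $x_t\mid x_0\sim\mathcal N((1-t)x_0,t^2I_d)$, so $$p_t(x)=\mathcal N\big(x;0,(t^2+(1-t)^2)I_d\big),\qquad p_t(x\mid y)=\sum_{k=1}^2\pi_k\,\mathcal N\big(x;(1-t)\mu_k,(t^2+(1-t)^2\sigma^2)I_d\big).$$ With $\alpha(t)=\frac1{1-t}$, $\beta(t)=\frac t{1-t}$ for $t\in[0,1)$, the CFG probability flow ODE with weight $\omega$ is $$\frac{dx_t}{dt}=-\alpha(t)x_t-\beta(t)\big[(1-\omega)\nabla_x\log p_t(x_t)+\omega\nabla_x\log p_t(x_t\mid y)\big].$$ It is solved backward in time, from $t=t_{s_2}$ down to $t=0$. Zero-thrust sets. Let $\Delta\mu=\mu_1-\mu_2$, $u(z)=\langle z,\Delta\mu\rangle$ for $z\in\mathbb R^d$, $\sigma_t^2=t^2+(1-t)^2\sigma^2$, $\psi(t)=\sigma_t^2/(1-t)^2$, $c(t)=\psi(t)\log(\pi_2/\pi_1)$, and $$g_t(u)=u-\frac{\|\Delta\mu\|^2}{2}\tanh\!\Big(\frac{(1-t)^2}{2\sigma_t^2}\,(u-c(t))\Big),\qquad u\in\mathbb R.$$ Then $$S_t=\{z\in\mathbb R^d:\ g_t(u(z))=0,\ u(z)>0,\ \langle z-\mu_1,z-\mu_2\rangle<0\}.$$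 (In the rescaled variable $z=x/(1-t)$, $S_t$ consists of points where the conditional ($\omega=1$) velocity field has zero component along $\Delta\mu$.) *)

theory Defs
  imports "HOL-Analysis.Analysis"
begin

definition gaussian :: "real ^ 'n \<Rightarrow> real ^ 'n \<Rightarrow> real ^ 'n ^ 'n \<Rightarrow> real" where
  "gaussian x m C =
     exp (- ((x - m) \<bullet> (matrix_inv C *v (x - m))) / 2) / sqrt ((2 * pi) ^ CARD('n) * det C)"

definition grad :: "('a::real_inner \<Rightarrow> real) \<Rightarrow> 'a \<Rightarrow> 'a" where
  "grad f x = (THE D. GDERIV f x :> D)"

text \<open>
  The marginals at time \<open>t\<close> of the forward kernel
  \<open>x\<^sub>t | x\<^sub>0 ~ N((1 - t) x\<^sub>0, t\<^sup>2 I)\<close>, in closed form, for the data law \<open>N(0, I)\<close> and for the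
  two-component mixture. Note that \<^term>\<open>mat c\<close> is the matrix \<open>c I\<close>.
\<close>

definition uncond_density :: "real \<Rightarrow> real ^ 'n \<Rightarrow> real" where
  "uncond_density t x = gaussian x 0 (mat (t\<^sup>2 + (1 - t)\<^sup>2))"

definition cond_density ::
  "real \<Rightarrow> real \<Rightarrow> real ^ 'n \<Rightarrow> real ^ 'n \<Rightarrow> real \<Rightarrow> real \<Rightarrow> real ^ 'n \<Rightarrow> real" where
  "cond_density \<pi>\<^sub>1 \<pi>\<^sub>2 \<mu>\<^sub>1 \<mu>\<^sub>2 \<sigma> t x =
     \<pi>\<^sub>1 * gaussian x ((1 - t) *\<^sub>R \<mu>\<^sub>1) (mat (t\<^sup>2 + (1 - t)\<^sup>2 * \<sigma>\<^sup>2)) +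
     \<pi>\<^sub>2 * gaussian x ((1 - t) *\<^sub>R \<mu>\<^sub>2) (mat (t\<^sup>2 + (1 - t)\<^sup>2 * \<sigma>\<^sup>2))"

lemma uncond_density_0: "uncond_density 0 x = gaussian x 0 (mat 1)"
  by (simp add: uncond_density_def)

lemma cond_density_0:
  "cond_density \<pi>\<^sub>1 \<pi>\<^sub>2 \<mu>\<^sub>1 \<mu>\<^sub>2 \<sigma> 0 x =
     \<pi>\<^sub>1 * gaussian x \<mu>\<^sub>1 (mat (\<sigma>\<^sup>2)) + \<pi>\<^sub>2 * gaussian x \<mu>\<^sub>2 (mat (\<sigma>\<^sup>2))"
  by (simp add: cond_density_def)

definition cfg_alpha :: "real \<Rightarrow> real" where
  "cfg_alpha t = 1 / (1 - t)"

definition cfg_beta :: "real \<Rightarrow> real" where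
  "cfg_beta t = t / (1 - t)"

definition cfg_velocity ::
  "real \<Rightarrow> real \<Rightarrow> real ^ 'n \<Rightarrow> real ^ 'n \<Rightarrow> real \<Rightarrow> real \<Rightarrow> real \<Rightarrow> real ^ 'n \<Rightarrow> real ^ 'n" where
  "cfg_velocity \<pi>\<^sub>1 \<pi>\<^sub>2 \<mu>\<^sub>1 \<mu>\<^sub>2 \<sigma> \<omega> t x =
     - (cfg_alpha t *\<^sub>R x) - cfg_beta t *\<^sub>R
         ((1 - \<omega>) *\<^sub>R grad (\<lambda>x. ln (uncond_density t x)) x +
          \<omega> *\<^sub>R grad (\<lambda>x. ln (cond_density \<pi>\<^sub>1 \<pi>\<^sub>2 \<mu>\<^sub>1 \<mu>\<^sub>2 \<sigma> t x)) x)"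

text \<open>
  A trajectory on \<open>[0, T]\<close>. The ODE is run backward from \<open>T\<close> but is written in the forward
  variable \<open>t\<close>; the derivatives at the two endpoints are one-sided.
\<close>

definition follows_cfg_ode ::
  "real \<Rightarrow> real \<Rightarrow> real ^ 'n \<Rightarrow> real ^ 'n \<Rightarrow> real \<Rightarrow> real \<Rightarrow> real \<Rightarrow> (real \<Rightarrow> real ^ 'n) \<Rightarrow> bool" where
  "follows_cfg_ode \<pi>\<^sub>1 \<pi>\<^sub>2 \<mu>\<^sub>1 \<mu>\<^sub>2 \<sigma> \<omega> T x \<longleftrightarrow>
     (\<forall>t\<in>{0..T}. (x has_vector_derivative cfg_velocity \<pi>\<^sub>1 \<pi>\<^sub>2 \<mu>\<^sub>1 \<mu>\<^sub>2 \<sigma> \<omega> t (x t))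
        (at t within {0..T}))"

definition zt_var :: "real \<Rightarrow> real \<Rightarrow> real" where
  "zt_var \<sigma> t = t\<^sup>2 + (1 - t)\<^sup>2 * \<sigma>\<^sup>2"

definition zt_psi :: "real \<Rightarrow> real \<Rightarrow> real" where
  "zt_psi \<sigma> t = zt_var \<sigma> t / (1 - t)\<^sup>2"

definition zt_c :: "real \<Rightarrow> real \<Rightarrow> real \<Rightarrow> real \<Rightarrow> real" where
  "zt_c \<pi>\<^sub>1 \<pi>\<^sub>2 \<sigma> t = zt_psi \<sigma> t * ln (\<pi>\<^sub>2 / \<pi>\<^sub>1)"

definition zt_g ::
  "real \<Rightarrow> real \<Rightarrow> real ^ 'n \<Rightarrow> real ^ 'n \<Rightarrow> real \<Rightarrow> real \<Rightarrow> real \<Rightarrow> real" where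
  "zt_g \<pi>\<^sub>1 \<pi>\<^sub>2 \<mu>\<^sub>1 \<mu>\<^sub>2 \<sigma> t u =
     u - (norm (\<mu>\<^sub>1 - \<mu>\<^sub>2))\<^sup>2 / 2 *
       tanh ((1 - t)\<^sup>2 / (2 * zt_var \<sigma> t) * (u - zt_c \<pi>\<^sub>1 \<pi>\<^sub>2 \<sigma> t))"

definition zero_thrust_set ::
  "real \<Rightarrow> real \<Rightarrow> real ^ 'n \<Rightarrow> real ^ 'n \<Rightarrow> real \<Rightarrow> real \<Rightarrow> (real ^ 'n) set" where
  "zero_thrust_set \<pi>\<^sub>1 \<pi>\<^sub>2 \<mu>\<^sub>1 \<mu>\<^sub>2 \<sigma> t =
     {z. zt_g \<pi>\<^sub>1 \<pi>\<^sub>2 \<mu>\<^sub>1 \<mu>\<^sub>2 \<sigma> t (z \<bullet> (\<mu>\<^sub>1 - \<mu>\<^sub>2)) = 0 \<and>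
         z \<bullet> (\<mu>\<^sub>1 - \<mu>\<^sub>2) > 0 \<and>
         (z - \<mu>\<^sub>1) \<bullet> (z - \<mu>\<^sub>2) < 0}"

end

theory Submission
  imports Defs
begin

text \<open>
  In the rescaled variable \<open>z = x / (1 - t)\<close> the component \<open>u = z \<bullet> (\<mu>\<^sub>1 - \<mu>\<^sub>2)\<close> obeys the scalar
  equation \<open>u' = t / (1 - t) * ((1 - \<omega>) u / (t\<^sup>2 + (1 - t)\<^sup>2) + \<omega> g\<^sub>t(u) / \<sigma>\<^sub>t\<^sup>2)\<close>, and the first mode
  dominates exactly when \<open>u > c(t)\<close>. For fixed \<open>u > 0\<close> the value \<open>g\<^sub>t(u)\<close> is strictly increasing in
  \<open>t\<close>, so a positive root \<open>a\<close> of \<open>g\<close> at time \<open>t\<^sub>0\<close> satisfies \<open>g\<^sub>t(a) < 0\<close> at every earlier time.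
  Hence \<open>u' < 0\<close> whenever \<open>u = a\<close> and \<open>0 < t < t\<^sub>0\<close>, whatever \<open>\<omega> \<ge> 1\<close> is: run backward in time, a
  trajectory starting above the level \<open>a\<close> cannot cross it. Finally \<open>a > c(t\<^sub>0) \<ge> c(t)\<close>, since
  the \<open>tanh\<close> in \<open>g\<close> is positive at the root.
\<close>

section \<open>Scalar matrices and isotropic Gaussians\<close>

lemma matrix_inv_unique:
  fixes A :: "'a::semiring_1 ^ 'n ^ 'm"
  assumes "A ** B = mat 1" "B ** A = mat 1"
  shows "matrix_inv A = B"
proof -
  have inv: "A ** matrix_inv A = mat 1 \<and> matrix_inv A ** A = mat 1"
    unfolding matrix_inv_def by (rule someI[of _ B]) (use assms in simp)
  have "matrix_inv A = (B ** A) ** matrix_inv A"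
    by (simp add: assms)
  also have "\<dots> = B"
    by (simp add: inv flip: matrix_mul_assoc)
  finally show ?thesis .
qed

lemma mat_mult_vector: "mat c *v x = c *s (x :: 'a::semiring_1 ^ 'n)"
  by (simp add: vec_eq_iff matrix_vector_mult_def mat_def if_distrib[of "\<lambda>a. a * _"] cong: if_cong)

lemma mat_mult_mat: "mat c ** mat d = (mat (c * d) :: 'a::semiring_1 ^ 'n ^ 'n)"
  by (simp add: vec_eq_iff matrix_matrix_mult_def mat_def
      if_distrib[of "\<lambda>a. a * _"] cong: if_cong)

lemma matrix_inv_mat:
  "c \<noteq> 0 \<Longrightarrow> matrix_inv (mat c :: 'a::field ^ 'n ^ 'n) = mat (inverse c)"
  by (rule matrix_inv_unique) (simp_all add: mat_mult_mat)

lemma det_mat: "det (mat c :: 'a::comm_ring_1 ^ 'n ^ 'n) = c ^ CARD('n)"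
  by (simp add: det_diagonal mat_def)

lemma gaussian_mat:
  fixes x m :: "real ^ 'n"
  assumes "v > 0"
  shows "gaussian x m (mat v) = exp (- ((x - m) \<bullet> (x - m)) / (2 * v)) / sqrt ((2 * pi * v) ^ CARD('n))"
proof -
  have "(x - m) \<bullet> (matrix_inv (mat v) *v (x - m)) = ((x - m) \<bullet> (x - m)) / v"
    using assms by (simp add: matrix_inv_mat mat_mult_vector scalar_mult_eq_scaleR divide_inverse_commute)
  then show ?thesis
    using assms by (simp add: gaussian_def det_mat power_mult_distrib)
qed

lemma gaussian_mat_pos: "v > 0 \<Longrightarrow> gaussian x m (mat v) > 0"
  by (simp add: gaussian_mat)

section \<open>Gradients of log-densities\<close>

lemma GDERIV_gaussian:
  fixes x m :: "real ^ 'n"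
  assumes "v > 0"
  shows "GDERIV (\<lambda>x. gaussian x m (mat v)) x :> - (gaussian x m (mat v) / v) *\<^sub>R (x - m)"
proof -
  define N where "N = sqrt ((2 * pi * v) ^ CARD('n))"
  have "N > 0" using assms by (simp add: N_def)
  then show ?thesis
    unfolding gaussian_mat[OF assms] gderiv_def N_def[symmetric] using assms
    by (auto intro!: derivative_eq_intros simp: fun_eq_iff inner_commute divide_simps)
qed

text \<open>\<open>grad\<close> is a definite description; uniqueness of the Frechet derivative at a
  point lets any exhibited gradient evaluate it.\<close>

lemma grad_eqI:
  assumes "GDERIV f x :> D"
  shows "grad f x = D"
  unfolding grad_def
proof (rule the_equality)
  show "GDERIV f x :> D" by (fact assms)
next
  fix E assume "GDERIV f x :> E"
  then have "(\<lambda>h. h \<bullet> E) = (\<lambda>h. h \<bullet> D)"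
    using assms unfolding gderiv_def by (rule has_derivative_unique)
  then show "E = D"
    by (metis vector_eq_ldot)
qed

lemma grad_ln:
  assumes "GDERIV f x :> D" "f x > 0"
  shows "grad (\<lambda>x. ln (f x)) x = D /\<^sub>R f x"
  using GDERIV_DERIV_compose[OF assms(1) DERIV_ln[OF assms(2)]] by (rule grad_eqI)

lemma zt_var_pos: "0 < \<sigma> \<Longrightarrow> t < 1 \<Longrightarrow> zt_var \<sigma> t > 0"
  unfolding zt_var_def by (intro add_nonneg_pos) auto

lemma grad_ln_uncond:
  assumes "t < 1"
  shows "grad (\<lambda>x. ln (uncond_density t x)) x = - (1 / (t\<^sup>2 + (1 - t)\<^sup>2)) *\<^sub>R x"
proof -
  have v: "t\<^sup>2 + (1 - t)\<^sup>2 > 0"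
    using assms by (intro add_nonneg_pos) auto
  show ?thesis
    unfolding uncond_density_def grad_ln[OF GDERIV_gaussian[OF v] gaussian_mat_pos[OF v]]
    using gaussian_mat_pos[OF v, of x 0] by simp
qed

section \<open>Log-ratio of the two weighted components\<close>

lemma zt_psi_pos: "0 < \<sigma> \<Longrightarrow> t < 1 \<Longrightarrow> zt_psi \<sigma> t > 0"
  by (simp add: zt_psi_def zt_var_pos)

text \<open>The factor \<open>zt_psi\<close> inside \<open>zt_c\<close> cancels, so time enters the
  tanh argument of \<open>zt_g\<close> only through \<open>u / (2 * zt_psi \<sigma> t)\<close>.
  Monotonicity in time is read off from this form.\<close>

lemma zt_half_log_ratio:
  assumes "0 < \<sigma>" "t < 1"
  shows "(1 - t)\<^sup>2 / (2 * zt_var \<sigma> t) * (u - zt_c \<pi>\<^sub>1 \<pi>\<^sub>2 \<sigma> t) =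
    u / (2 * zt_psi \<sigma> t) - ln (\<pi>\<^sub>2 / \<pi>\<^sub>1) / 2"
  using zt_var_pos[OF assms] assms by (simp add: zt_c_def zt_psi_def field_simps)

text \<open>Both components have the same covariance and, by the equal norms, the same term
  quadratic in the mean. Only the cross terms with \<open>x\<close> survive, so the log-ratio is
  affine in \<open>u\<close>: it is twice the tanh argument of \<open>zt_g\<close>.\<close>

lemma weighted_gaussian_ratio:
  fixes \<mu>\<^sub>1 \<mu>\<^sub>2 x :: "real ^ 'n"
  assumes "0 < \<sigma>" "t < 1" "norm \<mu>\<^sub>1 = norm \<mu>\<^sub>2" "\<pi>\<^sub>1 > 0" "\<pi>\<^sub>2 > 0"
  defines "u \<equiv> (x \<bullet> (\<mu>\<^sub>1 - \<mu>\<^sub>2)) / (1 - t)"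
  shows "\<pi>\<^sub>1 * gaussian x ((1 - t) *\<^sub>R \<mu>\<^sub>1) (mat (zt_var \<sigma> t)) =
    exp (2 * ((1 - t)\<^sup>2 / (2 * zt_var \<sigma> t) * (u - zt_c \<pi>\<^sub>1 \<pi>\<^sub>2 \<sigma> t))) *
    (\<pi>\<^sub>2 * gaussian x ((1 - t) *\<^sub>R \<mu>\<^sub>2) (mat (zt_var \<sigma> t)))"
proof -
  let ?v = "zt_var \<sigma> t"
  have v: "?v > 0" using assms by (intro zt_var_pos)
  have n: "\<mu>\<^sub>1 \<bullet> \<mu>\<^sub>1 = \<mu>\<^sub>2 \<bullet> \<mu>\<^sub>2"
    using assms(3) by (simp add: dot_square_norm)
  let ?q = "\<lambda>m. - ((x - (1 - t) *\<^sub>R m) \<bullet> (x - (1 - t) *\<^sub>R m)) / (2 * ?v)"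
  have sq: "(x - r *\<^sub>R m) \<bullet> (x - r *\<^sub>R m) = x \<bullet> x - 2 * r * (x \<bullet> m) + r\<^sup>2 * (m \<bullet> m)" for r m
    by (simp add: inner_diff inner_commute power2_eq_square)
  have "u / zt_psi \<sigma> t = (1 - t) * (x \<bullet> \<mu>\<^sub>1 - x \<bullet> \<mu>\<^sub>2) / ?v"
    using assms(2) by (simp add: u_def zt_psi_def inner_diff power2_eq_square)
  moreover have "?q \<mu>\<^sub>1 - ?q \<mu>\<^sub>2 = (1 - t) * (x \<bullet> \<mu>\<^sub>1 - x \<bullet> \<mu>\<^sub>2) / ?v"
    unfolding sq n using v by (simp add: divide_simps) (simp add: algebra_simps)
  ultimately have "2 * ((1 - t)\<^sup>2 / (2 * ?v) * (u - zt_c \<pi>\<^sub>1 \<pi>\<^sub>2 \<sigma> t)) =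
      ?q \<mu>\<^sub>1 - ?q \<mu>\<^sub>2 - ln (\<pi>\<^sub>2 / \<pi>\<^sub>1)"
    unfolding zt_half_log_ratio[OF assms(1,2)] by simp
  \<comment> \<open>Here \<open>b\<close> stands for the normalising constant shared by both
    components.\<close>
  moreover have "exp (p - q - ln (\<pi>\<^sub>2 / \<pi>\<^sub>1)) * (\<pi>\<^sub>2 * (exp q / b)) = \<pi>\<^sub>1 * (exp p / b)" for p q b
    using assms(4,5) by (simp add: exp_diff)
  ultimately show ?thesis
    unfolding gaussian_mat[OF v] by presburger
qed

lemma weighted_gaussian_less_iff:
  fixes \<mu>\<^sub>1 \<mu>\<^sub>2 x :: "real ^ 'n"
  assumes "0 < \<sigma>" "t < 1" "norm \<mu>\<^sub>1 = norm \<mu>\<^sub>2" "\<pi>\<^sub>1 > 0" "\<pi>\<^sub>2 > 0"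
  shows "\<pi>\<^sub>2 * gaussian x ((1 - t) *\<^sub>R \<mu>\<^sub>2) (mat (zt_var \<sigma> t)) <
      \<pi>\<^sub>1 * gaussian x ((1 - t) *\<^sub>R \<mu>\<^sub>1) (mat (zt_var \<sigma> t)) \<longleftrightarrow>
    zt_c \<pi>\<^sub>1 \<pi>\<^sub>2 \<sigma> t < (x \<bullet> (\<mu>\<^sub>1 - \<mu>\<^sub>2)) / (1 - t)"
proof -
  have v: "zt_var \<sigma> t > 0" using assms by (intro zt_var_pos)
  have less: "K < exp y * K \<longleftrightarrow> 0 < y" if "K > 0" for K y :: real
    using that by simp
  show ?thesis
    unfolding weighted_gaussian_ratio[OF assms]
    by (subst less) (use assms v gaussian_mat_pos[OF v] in \<open>simp_all add: zero_less_mult_iff zero_less_divide_iff\<close>)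
qed

section \<open>The score and the flow projected on the difference of the means\<close>

text \<open>The mixture score averages the component scores with posterior weights
  \<open>E / (E + 1)\<close> and \<open>1 / (E + 1)\<close>, where \<open>E = exp (2 * y)\<close>.
  The difference of these weights is \<open>tanh y\<close>, which is how the tanh of
  \<open>zt_g\<close> arises.\<close>

lemma cond_score_inner:
  fixes \<mu>\<^sub>1 \<mu>\<^sub>2 x :: "real ^ 'n"
  assumes "0 < \<sigma>" "t < 1" "norm \<mu>\<^sub>1 = norm \<mu>\<^sub>2" "\<pi>\<^sub>1 > 0" "\<pi>\<^sub>2 > 0"
  defines "u \<equiv> (x \<bullet> (\<mu>\<^sub>1 - \<mu>\<^sub>2)) / (1 - t)"
  shows "grad (\<lambda>x. ln (cond_density \<pi>\<^sub>1 \<pi>\<^sub>2 \<mu>\<^sub>1 \<mu>\<^sub>2 \<sigma> t x)) x \<bullet> (\<mu>\<^sub>1 - \<mu>\<^sub>2) =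
    - ((1 - t) * zt_g \<pi>\<^sub>1 \<pi>\<^sub>2 \<mu>\<^sub>1 \<mu>\<^sub>2 \<sigma> t u / zt_var \<sigma> t)"
proof -
  let ?v = "zt_var \<sigma> t"
  define y where "y = (1 - t)\<^sup>2 / (2 * ?v) * (u - zt_c \<pi>\<^sub>1 \<pi>\<^sub>2 \<sigma> t)"
  define G where "G m x = gaussian x ((1 - t) *\<^sub>R m) (mat ?v)" for m x :: "real ^ 'n"
  have v: "?v > 0" using assms by (intro zt_var_pos)
  define K where "K = \<pi>\<^sub>2 * G \<mu>\<^sub>2 x"
  have K: "K > 0"
    unfolding K_def G_def by (intro mult_pos_pos gaussian_mat_pos v assms(5))
  have K1: "\<pi>\<^sub>1 * G \<mu>\<^sub>1 x = exp (2 * y) * K"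
    using weighted_gaussian_ratio[OF assms(1-5), of x] unfolding K_def G_def y_def u_def .
  have dens: "cond_density \<pi>\<^sub>1 \<pi>\<^sub>2 \<mu>\<^sub>1 \<mu>\<^sub>2 \<sigma> t = (\<lambda>x. \<pi>\<^sub>1 * G \<mu>\<^sub>1 x + \<pi>\<^sub>2 * G \<mu>\<^sub>2 x)"
    by (simp add: fun_eq_iff cond_density_def G_def zt_var_def)
  have GD: "GDERIV (\<lambda>x. p * G m x) x :> (p * G m x) *\<^sub>R (((1 - t) *\<^sub>R m - x) /\<^sub>R ?v)" for p m
    unfolding G_def
    by (rule GDERIV_subst[OF GDERIV_mult[OF GDERIV_const GDERIV_gaussian[OF v]]])
      (simp add: divide_inverse flip: scaleR_minus_right)
  have tanh: "tanh y = (exp (2 * y) - 1) / (exp (2 * y) + 1)"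
  proof -
    have "1 - inverse E = (E - 1) / E" "1 + inverse E = (E + 1) / E" if "E > 0" for E :: real
      using that by (simp_all add: field_simps)
    then show ?thesis
      by (simp add: tanh_real_altdef exp_minus)
  qed
  \<comment> \<open>Equal norms make the sum of the means orthogonal to their difference, so the
    means project to opposite values.\<close>
  have n: "\<mu>\<^sub>1 \<bullet> (\<mu>\<^sub>1 - \<mu>\<^sub>2) = (norm (\<mu>\<^sub>1 - \<mu>\<^sub>2))\<^sup>2 / 2" "\<mu>\<^sub>2 \<bullet> (\<mu>\<^sub>1 - \<mu>\<^sub>2) = - ((norm (\<mu>\<^sub>1 - \<mu>\<^sub>2))\<^sup>2 / 2)"
    using assms(3) by (simp_all add: power2_norm_eq_inner inner_diff inner_commute[of \<mu>\<^sub>2 \<mu>\<^sub>1] norm_eq field_simps)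
  have w: "x \<bullet> (\<mu>\<^sub>1 - \<mu>\<^sub>2) = (1 - t) * u"
    using assms(2) by (simp add: u_def)
  \<comment> \<open>The factor \<open>K\<close> is common to the density and its gradient and
    cancels.\<close>
  have alg1: "inverse (E * K + K) * (E * K * (inverse v * p) + K * (inverse v * q)) =
      (E * p + q) / ((E + 1) * v)" if "E > 0" "v > 0" for E v p q :: real
  proof -
    have "E * K + K = (E + 1) * K" "E + 1 \<noteq> 0"
      using that by (simp_all add: algebra_simps)
    then show ?thesis
      using K that by (simp add: divide_simps) (simp add: algebra_simps)
  qed
  have alg2: "(E * (r * b - r * u) + (r * - b - r * u)) / ((E + 1) * v) =
      - (r * (u - b * ((E - 1) / (E + 1))) / v)" if "E > 0" "v > 0" for E v b r :: real
  proof -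
    have "E + 1 \<noteq> 0"
      using that by simp
    then show ?thesis
      using that by (simp add: divide_simps) (simp add: algebra_simps)
  qed
  have "grad (\<lambda>x. ln (cond_density \<pi>\<^sub>1 \<pi>\<^sub>2 \<mu>\<^sub>1 \<mu>\<^sub>2 \<sigma> t x)) x =
      ((exp (2 * y) * K) *\<^sub>R (((1 - t) *\<^sub>R \<mu>\<^sub>1 - x) /\<^sub>R ?v) +
        K *\<^sub>R (((1 - t) *\<^sub>R \<mu>\<^sub>2 - x) /\<^sub>R ?v)) /\<^sub>R (exp (2 * y) * K + K)"
    unfolding dens
    using grad_ln[OF GDERIV_add[OF GD[of \<pi>\<^sub>1 \<mu>\<^sub>1] GD[of \<pi>\<^sub>2 \<mu>\<^sub>2]]] K
    unfolding K_def[symmetric] K1 by (simp add: add_pos_pos)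
  also have "\<dots> \<bullet> (\<mu>\<^sub>1 - \<mu>\<^sub>2) =
      (exp (2 * y) * ((1 - t) * ((norm (\<mu>\<^sub>1 - \<mu>\<^sub>2))\<^sup>2 / 2) - (1 - t) * u) +
        ((1 - t) * - ((norm (\<mu>\<^sub>1 - \<mu>\<^sub>2))\<^sup>2 / 2) - (1 - t) * u)) / ((exp (2 * y) + 1) * ?v)"
    unfolding inner_add_left inner_scaleR_left inner_diff_left[of _ x] w n
    by (rule alg1) (use v in simp_all)
  also have "\<dots> = - ((1 - t) * (u - (norm (\<mu>\<^sub>1 - \<mu>\<^sub>2))\<^sup>2 / 2 * tanh y) / ?v)"
    unfolding tanh by (rule alg2) (use v in simp_all)
  finally show ?thesis
    unfolding zt_g_def y_def .
qed

text \<open>Differentiating the factor \<open>1 / (1 - t)\<close> contributes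
  \<open>u t / (1 - t)\<close>, which cancels the linear drift from \<open>cfg_alpha\<close>. Only
  the two projected scores remain, with common factor \<open>t / (1 - t)\<close>.\<close>

lemma cfg_ode_projection:
  fixes \<mu>\<^sub>1 \<mu>\<^sub>2 :: "real ^ 'n"
  assumes "0 < \<sigma>" "T < 1" "norm \<mu>\<^sub>1 = norm \<mu>\<^sub>2" "\<pi>\<^sub>1 > 0" "\<pi>\<^sub>2 > 0"
    and ode: "follows_cfg_ode \<pi>\<^sub>1 \<pi>\<^sub>2 \<mu>\<^sub>1 \<mu>\<^sub>2 \<sigma> \<omega> T x" and t: "t \<in> {0..T}"
  defines "u \<equiv> \<lambda>t. (x t \<bullet> (\<mu>\<^sub>1 - \<mu>\<^sub>2)) / (1 - t)"
  shows "(u has_real_derivative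
      t / (1 - t) * ((1 - \<omega>) * u t / (t\<^sup>2 + (1 - t)\<^sup>2) +
        \<omega> * zt_g \<pi>\<^sub>1 \<pi>\<^sub>2 \<mu>\<^sub>1 \<mu>\<^sub>2 \<sigma> t (u t) / zt_var \<sigma> t)) (at t within {0..T})"
proof -
  let ?V = "cfg_velocity \<pi>\<^sub>1 \<pi>\<^sub>2 \<mu>\<^sub>1 \<mu>\<^sub>2 \<sigma> \<omega> t (x t)"
  let ?\<Delta> = "\<mu>\<^sub>1 - \<mu>\<^sub>2"
  have t1: "t < 1" using t assms(2) by auto
  have w: "x t \<bullet> ?\<Delta> = (1 - t) * u t" using t1 by (simp add: u_def)
  have "(x has_vector_derivative ?V) (at t within {0..T})"
    using ode t by (simp add: follows_cfg_ode_def)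
  then have "((\<lambda>t. x t \<bullet> ?\<Delta>) has_real_derivative ?V \<bullet> ?\<Delta>) (at t within {0..T})"
    unfolding has_real_derivative_iff_has_vector_derivative
    by (rule bounded_linear.has_vector_derivative[OF bounded_linear_inner_left])
  then have D: "(u has_real_derivative (?V \<bullet> ?\<Delta> * (1 - t) + x t \<bullet> ?\<Delta>) / (1 - t)\<^sup>2) (at t within {0..T})"
    unfolding u_def using t1
    by (auto intro!: derivative_eq_intros simp: power2_eq_square)
  have alg: "- (1 / r * (r * y)) - t / r * ((1 - \<omega>) * (- (1 / s) * (r * y)) + \<omega> * - (r * g / v)) =
      - y + t * ((1 - \<omega>) * y / s + \<omega> * g / v)" if "r > 0" for r s v y g :: real
  proof -
    have "(1 - \<omega>) * (- (1 / s) * (r * y)) + \<omega> * - (r * g / v) = - (r * ((1 - \<omega>) * y / s + \<omega> * g / v))"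
      by (simp add: algebra_simps add_divide_distrib diff_divide_distrib)
    then show ?thesis
      using that by simp
  qed
  have alg2: "((- y + t * q) * r + r * y) / r\<^sup>2 = t / r * q" if "r > 0" for r y q :: real
    using that by (simp add: power2_eq_square field_simps)
  have score: "grad (\<lambda>x. ln (cond_density \<pi>\<^sub>1 \<pi>\<^sub>2 \<mu>\<^sub>1 \<mu>\<^sub>2 \<sigma> t x)) (x t) \<bullet> ?\<Delta> =
      - ((1 - t) * zt_g \<pi>\<^sub>1 \<pi>\<^sub>2 \<mu>\<^sub>1 \<mu>\<^sub>2 \<sigma> t (u t) / zt_var \<sigma> t)"
    unfolding u_def by (rule cond_score_inner[OF assms(1) t1 assms(3-5)])
  have V: "?V \<bullet> ?\<Delta> = - u t + t * ((1 - \<omega>) * u t / (t\<^sup>2 + (1 - t)\<^sup>2) +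
      \<omega> * zt_g \<pi>\<^sub>1 \<pi>\<^sub>2 \<mu>\<^sub>1 \<mu>\<^sub>2 \<sigma> t (u t) / zt_var \<sigma> t)"
    unfolding cfg_velocity_def grad_ln_uncond[OF t1] inner_diff_left[of _ _ ?\<Delta>] inner_add_left
      inner_scaleR_left inner_minus_left score w
      cfg_alpha_def cfg_beta_def
    by (rule alg) (use t1 in simp)
  have "(?V \<bullet> ?\<Delta> * (1 - t) + x t \<bullet> ?\<Delta>) / (1 - t)\<^sup>2 =
      t / (1 - t) * ((1 - \<omega>) * u t / (t\<^sup>2 + (1 - t)\<^sup>2) +
        \<omega> * zt_g \<pi>\<^sub>1 \<pi>\<^sub>2 \<mu>\<^sub>1 \<mu>\<^sub>2 \<sigma> t (u t) / zt_var \<sigma> t)"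
    unfolding w V using t1 by (intro alg2) simp
  with D show ?thesis by simp
qed

section \<open>Monotonicity in time\<close>

lemma zt_psi_strict_mono:
  assumes "0 \<le> s" "s < t" "t < 1"
  shows "zt_psi \<sigma> s < zt_psi \<sigma> t"
proof -
  \<comment> \<open>The squared noise-to-signal ratio plus the component variance.\<close>
  have eq: "zt_psi \<sigma> r = (r / (1 - r))\<^sup>2 + \<sigma>\<^sup>2" if "r < 1" for r
    using that by (simp add: zt_psi_def zt_var_def add_divide_distrib power_divide)
  have "s / (1 - s) < t / (1 - t)"
    using assms by (simp add: field_simps)
  then have "(s / (1 - s))\<^sup>2 < (t / (1 - t))\<^sup>2"
    using assms by (intro power_strict_mono) auto
  then show ?thesis
    using assms by (simp add: eq)
qed

text \<open>For \<open>u > 0\<close> a larger \<open>zt_psi\<close> lowers the tanh argument, and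
  tanh enters \<open>zt_g\<close> with a negative coefficient, nonzero since the means
  differ.\<close>

lemma zt_g_strict_mono_time:
  assumes "0 < \<sigma>" "0 \<le> s" "s < t" "t < 1" "u > 0" "\<mu>\<^sub>1 \<noteq> \<mu>\<^sub>2"
  shows "zt_g \<pi>\<^sub>1 \<pi>\<^sub>2 \<mu>\<^sub>1 \<mu>\<^sub>2 \<sigma> s u < zt_g \<pi>\<^sub>1 \<pi>\<^sub>2 \<mu>\<^sub>1 \<mu>\<^sub>2 \<sigma> t u"
proof -
  have "u / (2 * zt_psi \<sigma> t) < u / (2 * zt_psi \<sigma> s)"
    using zt_psi_strict_mono[OF assms(2-4), of \<sigma>] zt_psi_pos[of \<sigma> s] zt_psi_pos[of \<sigma> t] assms
    by (intro divide_strict_left_mono) auto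
  then show ?thesis
    unfolding zt_g_def zt_half_log_ratio[OF assms(1,4)]
      zt_half_log_ratio[OF assms(1) less_trans[OF assms(3,4)]]
    using assms(6) by simp
qed

lemma zt_g_root_gt_c:
  assumes "0 < \<sigma>" "t < 1" "u > 0" "zt_g \<pi>\<^sub>1 \<pi>\<^sub>2 \<mu>\<^sub>1 \<mu>\<^sub>2 \<sigma> t u = 0"
  shows "zt_c \<pi>\<^sub>1 \<pi>\<^sub>2 \<sigma> t < u"
proof -
  let ?y = "(1 - t)\<^sup>2 / (2 * zt_var \<sigma> t) * (u - zt_c \<pi>\<^sub>1 \<pi>\<^sub>2 \<sigma> t)"
  have "(norm (\<mu>\<^sub>1 - \<mu>\<^sub>2))\<^sup>2 / 2 * tanh ?y > 0"
    using assms(3,4) by (simp only: zt_g_def)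
  then have "?y > 0"
    by (simp add: zero_less_mult_iff)
  then show ?thesis
    using zt_var_pos[OF assms(1,2)] by (simp add: zero_less_mult_iff zero_less_divide_iff)
qed

section \<open>A barrier for scalar equations run backward\<close>

text \<open>If \<open>u r < a\<close>, let \<open>s\<close> be the last time after \<open>r\<close>
  at level \<open>a\<close>. The negative slope pushes \<open>u\<close> below \<open>a\<close> just
  after \<open>s\<close>, and \<open>u T > a\<close> forces a later crossing, a contradiction. Such
  an \<open>s\<close> is interior, so the sign of the slope is required only on the open
  interval.\<close>

lemma backward_barrier:
  fixes u D :: "real \<Rightarrow> real"
  assumes deriv: "\<And>t. t \<in> {S..T} \<Longrightarrow> (u has_real_derivative D t) (at t within {S..T})"
    and neg: "\<And>t. S < t \<Longrightarrow> t < T \<Longrightarrow> u t = a \<Longrightarrow> D t < 0"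
    and "u T > a" and r: "r \<in> {S..T}"
  shows "u r \<ge> a"
proof (rule ccontr)
  assume "\<not> u r \<ge> a"
  then have ra: "u r < a" by simp
  have cont: "continuous_on {S..T} u"
    by (rule DERIV_continuous_on[OF deriv])
  then have contr: "continuous_on {r..T} u"
    by (rule continuous_on_subset) (use r in auto)
  have "closed ({r..T} \<inter> u -` {a})"
    by (rule continuous_closed_preimage[OF contr]) auto
  then have "compact ({r..T} \<inter> ({r..T} \<inter> u -` {a}))"
    by (intro compact_Int_closed) auto
  moreover have "{r..T} \<inter> ({r..T} \<inter> u -` {a}) = {t\<in>{r..T}. u t = a}"
    by auto
  moreover obtain t where "r \<le> t" "t \<le> T" "u t = a"
    using IVT'[of u r a T] ra assms(3) r contr by auto
  ultimately obtain s where s: "s \<in> {r..T}" "u s = a"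
      and max: "\<And>t. t \<in> {r..T} \<Longrightarrow> u t = a \<Longrightarrow> t \<le> s"
    using compact_attains_sup[of "{t\<in>{r..T}. u t = a}"] by auto
  have "s \<noteq> r" "s \<noteq> T"
    using s ra assms(3) by auto
  then have sr: "r < s" "s < T"
    using s by auto
  then have "D s < 0"
    using neg s r by auto
  moreover have "s \<in> {S..T}"
    using s r by auto
  ultimately obtain d where d: "d > 0" "\<forall>h>0. s + h \<in> {S..T} \<longrightarrow> h < d \<longrightarrow> u (s + h) < u s"
    using has_real_derivative_neg_dec_right[OF deriv] by blast
  \<comment> \<open>Halving \<open>d\<close> gives \<open>h < d\<close>; the cap
    \<open>T - s\<close> keeps \<open>s + h\<close> in the interval.\<close>
  define h where "h = min (d / 2) (T - s)"
  have h: "h > 0" "h < d" "s + h \<le> T"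
    using d sr by (auto simp: h_def min_def)
  then have "u (s + h) < a"
    using d(2) s r sr by auto
  then obtain t where "s + h \<le> t" "t \<le> T" "u t = a"
    using IVT'[of u "s + h" a T] assms(3) h continuous_on_subset[OF contr, of "{s + h..T}"] sr by auto
  then show False
    using max[of t] h sr by auto
qed

section \<open>A half-space of starting points uniform in the weight\<close>

theorem theorem3p3:
  fixes \<mu>\<^sub>1 \<mu>\<^sub>2 :: "real ^ 'n" and \<pi>\<^sub>1 \<pi>\<^sub>2 \<sigma> :: real
  assumes "0 < \<sigma>" and "\<sigma> < 1"
    and "norm \<mu>\<^sub>1 = norm \<mu>\<^sub>2"
    and "\<pi>\<^sub>1 > 0" and "\<pi>\<^sub>2 > 0" and "\<pi>\<^sub>1 + \<pi>\<^sub>2 = 1" and "\<pi>\<^sub>1 < \<pi>\<^sub>2"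
    and "\<exists>t\<^sub>0\<in>{0<..<1}. \<forall>t\<in>{0..t\<^sub>0}. zero_thrust_set \<pi>\<^sub>1 \<pi>\<^sub>2 \<mu>\<^sub>1 \<mu>\<^sub>2 \<sigma> t \<noteq> {}"
  shows "\<exists>T\<in>{0<..<1}. \<exists>U :: (real ^ 'n) set. open U \<and> U \<noteq> {} \<and>
    (\<forall>\<omega>\<ge>1. \<forall>x :: real \<Rightarrow> real ^ 'n.
       x T \<in> U \<longrightarrow> follows_cfg_ode \<pi>\<^sub>1 \<pi>\<^sub>2 \<mu>\<^sub>1 \<mu>\<^sub>2 \<sigma> \<omega> T x \<longrightarrow>
       (\<forall>t\<in>{0..T}.
          \<pi>\<^sub>1 * gaussian (x t) ((1 - t) *\<^sub>R \<mu>\<^sub>1) (mat (t\<^sup>2 + (1 - t)\<^sup>2 * \<sigma>\<^sup>2)) >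
          \<pi>\<^sub>2 * gaussian (x t) ((1 - t) *\<^sub>R \<mu>\<^sub>2) (mat (t\<^sup>2 + (1 - t)\<^sup>2 * \<sigma>\<^sup>2))))"
proof -
  let ?\<Delta> = "\<mu>\<^sub>1 - \<mu>\<^sub>2"
  obtain T where T: "0 < T" "T < 1" and "zero_thrust_set \<pi>\<^sub>1 \<pi>\<^sub>2 \<mu>\<^sub>1 \<mu>\<^sub>2 \<sigma> T \<noteq> {}"
    using assms(8) by force
  then obtain z where z: "zt_g \<pi>\<^sub>1 \<pi>\<^sub>2 \<mu>\<^sub>1 \<mu>\<^sub>2 \<sigma> T (z \<bullet> ?\<Delta>) = 0" "z \<bullet> ?\<Delta> > 0"
    by (auto simp: zero_thrust_set_def)
  define a where "a = z \<bullet> ?\<Delta>"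
  have a: "a > 0" and \<Delta>: "\<mu>\<^sub>1 \<noteq> \<mu>\<^sub>2"
    using z by (auto simp: a_def)
  \<comment> \<open>Time \<open>T\<close> is excluded, since \<open>zt_g\<close> vanishes at
    \<open>a\<close> there.\<close>
  have g_neg: "zt_g \<pi>\<^sub>1 \<pi>\<^sub>2 \<mu>\<^sub>1 \<mu>\<^sub>2 \<sigma> t a < 0" if "0 \<le> t" "t < T" for t
    using zt_g_strict_mono_time[OF assms(1) that T(2) a \<Delta>, of \<pi>\<^sub>1 \<pi>\<^sub>2] z(1) by (simp add: a_def)
  have c_less: "zt_c \<pi>\<^sub>1 \<pi>\<^sub>2 \<sigma> t < a" if t: "t \<in> {0..T}" for t
  proof -
    have "zt_psi \<sigma> t \<le> zt_psi \<sigma> T"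
      using zt_psi_strict_mono[of t T \<sigma>] t T by (cases "t = T") auto
    then have "zt_c \<pi>\<^sub>1 \<pi>\<^sub>2 \<sigma> t \<le> zt_c \<pi>\<^sub>1 \<pi>\<^sub>2 \<sigma> T"
      unfolding zt_c_def using assms by (intro mult_right_mono) auto
    also have "\<dots> < a"
      using zt_g_root_gt_c[OF assms(1) T(2) z(2,1)] by (simp add: a_def)
    finally show ?thesis .
  qed
  \<comment> \<open>An open half-space: \<open>a\<close> and \<open>T\<close> come from the mixture
    alone, and the strict inequality starts the trajectory strictly above the barrier.\<close>
  define U where "U = {x. a < (x \<bullet> ?\<Delta>) / (1 - T)}"
  have "open U"
    unfolding U_def by (intro open_Collect_less continuous_intros) (use T in auto)
  \<comment> \<open>The point \<open>z\<close> itself lies at level \<open>a\<close>; doubling it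
    moves it strictly beyond.\<close>
  moreover have "(1 - T) *\<^sub>R 2 *\<^sub>R z \<in> U"
  proof -
    have "((1 - T) *\<^sub>R 2 *\<^sub>R z) \<bullet> ?\<Delta> / (1 - T) = 2 * a"
      unfolding inner_scaleR_left a_def[symmetric]
      using T by (intro nonzero_mult_div_cancel_left) simp
    then show ?thesis
      unfolding U_def using a by (simp only: mem_Collect_eq)
  qed
  moreover have "\<pi>\<^sub>2 * gaussian (x t) ((1 - t) *\<^sub>R \<mu>\<^sub>2) (mat (t\<^sup>2 + (1 - t)\<^sup>2 * \<sigma>\<^sup>2)) <
      \<pi>\<^sub>1 * gaussian (x t) ((1 - t) *\<^sub>R \<mu>\<^sub>1) (mat (t\<^sup>2 + (1 - t)\<^sup>2 * \<sigma>\<^sup>2))"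
    if \<omega>: "\<omega> \<ge> 1" and x: "x T \<in> U" and ode: "follows_cfg_ode \<pi>\<^sub>1 \<pi>\<^sub>2 \<mu>\<^sub>1 \<mu>\<^sub>2 \<sigma> \<omega> T x"
      and t: "t \<in> {0..T}" for \<omega> x t
  proof -
    define u where "u = (\<lambda>t. (x t \<bullet> ?\<Delta>) / (1 - t))"
    have "a \<le> u t"
    proof (rule backward_barrier[OF _ _ _ t])
      show "(u has_real_derivative
          r / (1 - r) * ((1 - \<omega>) * u r / (r\<^sup>2 + (1 - r)\<^sup>2) +
            \<omega> * zt_g \<pi>\<^sub>1 \<pi>\<^sub>2 \<mu>\<^sub>1 \<mu>\<^sub>2 \<sigma> r (u r) / zt_var \<sigma> r)) (at r within {0..T})"
        if "r \<in> {0..T}" for r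
        unfolding u_def by (rule cfg_ode_projection[OF assms(1) T(2) assms(3-5) ode that])
      show "r / (1 - r) * ((1 - \<omega>) * u r / (r\<^sup>2 + (1 - r)\<^sup>2) +
            \<omega> * zt_g \<pi>\<^sub>1 \<pi>\<^sub>2 \<mu>\<^sub>1 \<mu>\<^sub>2 \<sigma> r (u r) / zt_var \<sigma> r) < 0"
        if r: "0 < r" "r < T" "u r = a" for r
      proof -
        \<comment> \<open>The unconditional term has the right sign only weakly (it vanishes at
          \<open>\<omega> = 1\<close>); strictness comes from \<open>g_neg\<close>.\<close>
        have "(1 - \<omega>) * a / (r\<^sup>2 + (1 - r)\<^sup>2) \<le> 0"
          using \<omega> a by (intro divide_nonpos_nonneg mult_nonpos_nonneg) auto
        moreover have "\<omega> * zt_g \<pi>\<^sub>1 \<pi>\<^sub>2 \<mu>\<^sub>1 \<mu>\<^sub>2 \<sigma> r a / zt_var \<sigma> r < 0"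
          using \<omega> g_neg[of r] r T zt_var_pos[OF assms(1), of r]
          by (intro divide_neg_pos mult_pos_neg) auto
        ultimately show ?thesis
          unfolding r(3) using r T by (intro mult_pos_neg) auto
      qed
      show "a < u T"
        using x by (simp add: U_def u_def)
    qed
    then have "zt_c \<pi>\<^sub>1 \<pi>\<^sub>2 \<sigma> t < (x t \<bullet> ?\<Delta>) / (1 - t)"
      using c_less[OF t] by (simp add: u_def)
    then show ?thesis
      using weighted_gaussian_less_iff[OF assms(1) _ assms(3-5), of t "x t"] t T
      by (simp add: zt_var_def)
  qed
  ultimately show ?thesis
    using T by (intro bexI[of _ T] exI[of _ U]) auto
qed

end
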